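(* If $n$ is an overpseudoprime to base 2 and $n$ is not divisible by $p^2$ for any Wieferich prime $p$, then $n$ is squarefree.
   Context: A prime $p$ is a Wieferich prime if $2^{p-1}\equiv 1\pmod{p^2}$. For an odd integer $m>1$, $h(m)$ denotes the multiplicative order of 2 modulo $m$. The cyclotomic cosets of 2 modulo $m$ are the orbits of $\{1,2,\ldots,m-1\}$ under $x\mapsto 2x \bmod m$; $r(m)$ is their number. An odd composite number $n$ is called an overpseudoprime to base 2 if $n=r(n)h(n)+1$. *)

theory Defs
  imports
    "HOL-Number_Theory.Number_Theory"
    "HOL-Computational_Algebra.Squarefree"
    "HOL-Combinatorics.Orbits"
begin

definition wieferich_prime :: "nat \<Rightarrow> bool" where
  "wieferich_prime p \<longleftrightarrow> prime p \<and> [2 ^ (p - 1) = 1] (mod p\<^sup>2)"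

(* The library's orbit collects the iterates with positive exponent. For odd m, doubling
   permutes {1..<m}, so these are the usual orbits and each contains its base point. *)
definition cyclotomic_cosets :: "nat \<Rightarrow> nat set set" where
  "cyclotomic_cosets m = orbit (\<lambda>x. 2 * x mod m) ` {1..<m}"

definition num_cyclotomic_cosets :: "nat \<Rightarrow> nat" where
  "num_cyclotomic_cosets m = card (cyclotomic_cosets m)"

definition overpseudoprime :: "nat \<Rightarrow> bool" where
  "overpseudoprime n \<longleftrightarrow>
     odd n \<and> n > 1 \<and> \<not> prime n \<and> n = num_cyclotomic_cosets n * ord n 2 + 1"

end

theory Submission
  imports Defs
begin

text \<open>
  Every coset has at most $h(n)$ elements, so $n - 1 = r(n) h(n)$ forces all of them to have
  exactly $h(n)$ elements. If $p^2$ divides $n$, the coset of $n / p$ has at most $h(p)$ elements;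
  hence $h(n) \<le> h(p)$, while $h(p)$ divides $h(n)$. So $h(n) = h(p)$ divides $p - 1$, and since
  $p^2$ divides $2^{h(n)} - 1$, the prime $p$ is a Wieferich prime.
\<close>

lemma funpow_double_mod:
  fixes n x :: nat
  assumes "x < n"
  shows "((\<lambda>x. 2 * x mod n) ^^ k) x = 2 ^ k * x mod n"
  using assms by (induction k) (simp_all add: mod_mult_right_eq mult.assoc)

text \<open>The iterates repeat after \<open>d\<close> steps, so the exponents below
  \<open>d\<close> already reach the whole orbit.\<close>

lemma card_orbit_le:
  assumes "0 < d" "(f ^^ d) x = x"
  shows "card (orbit f x) \<le> d"
proof -
  have "orbit f x = (\<lambda>k. (f ^^ k) x) ` {..<d}"
    unfolding orbit_altdef_bounded[OF assms(2,1)] by blast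
  then show ?thesis
    using card_image_le[of "{..<d}" "\<lambda>k. (f ^^ k) x"] by simp
qed

text \<open>Periodicity makes the orbits a partition of \<open>S\<close>, so their sizes sum to
  \<open>card S\<close>. Each size is at most \<open>h\<close> and their average is
  \<open>h\<close>, which leaves no room for a smaller one.\<close>

lemma card_orbit_eq_if_all_bounded:
  assumes "finite S" and closed: "\<And>x. x \<in> S \<Longrightarrow> f x \<in> S"
    and per: "\<And>x. x \<in> S \<Longrightarrow> (f ^^ h) x = x" and "0 < h"
    and card: "card S = card (orbit f ` S) * h" and "x \<in> S"
  shows "card (orbit f x) = h"
proof -
  \<comment> \<open>\<open>orbit\<close> collects only positive iterates; the positive period
    \<open>h\<close> brings \<open>x\<close> back.\<close>
  have self: "x \<in> orbit f x" if "x \<in> S" for x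
    unfolding orbit_altdef mem_Collect_eq
    using per[OF that] \<open>0 < h\<close> by (intro exI[of _ h] conjI) (rule sym)
  have sub: "orbit f x \<subseteq> S" if "x \<in> S" for x
  proof
    fix y assume "y \<in> orbit f x"
    then show "y \<in> S" by induction (use that closed in auto)
  qed
  have disj: "pairwise disjnt (orbit f ` S)"
  proof (rule pairwiseI, rule ccontr)
    fix A B assume "A \<in> orbit f ` S" "B \<in> orbit f ` S" "A \<noteq> B" "\<not> disjnt A B"
    then obtain x y z where xy: "x \<in> S" "y \<in> S" "orbit f x \<noteq> orbit f y"
      and "z \<in> orbit f x" "z \<in> orbit f y"
      by (auto simp: disjnt_iff)
    \<comment> \<open>A cyclic set is the orbit of each of its points, so both sets equal
      \<open>orbit f z\<close>.\<close>
    moreover have "cyclic_on f (orbit f x)" "cyclic_on f (orbit f y)"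
      unfolding cyclic_on_def using self xy by blast+
    ultimately show False
      using orbit_cyclic_eq3 by metis
  qed
  have "(\<Union>x\<in>S. orbit f x) = S"
    using self sub by blast
  with disj have "card S = (\<Sum>A\<in>orbit f ` S. card A)"
    using card_Union_disjoint[of "orbit f ` S"] sub \<open>finite S\<close> finite_subset by fastforce
  with card have eq: "(\<Sum>A\<in>orbit f ` S. card A) = (\<Sum>A\<in>orbit f ` S. h)"
    by simp
  show ?thesis
  proof (rule ccontr)
    assume "card (orbit f x) \<noteq> h"
    have le: "\<forall>A\<in>orbit f ` S. card A \<le> h"
      using card_orbit_le[OF \<open>0 < h\<close> per] by auto
    have "(\<Sum>A\<in>orbit f ` S. card A) < (\<Sum>A\<in>orbit f ` S. h)"
    proof (rule sum_strict_mono_ex1)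
      show "\<exists>A\<in>orbit f ` S. card A < h"
        using le \<open>card (orbit f x) \<noteq> h\<close> \<open>x \<in> S\<close> by (intro bexI[of _ "orbit f x"]) auto
    qed (use le \<open>finite S\<close> in auto)
    with eq show False by simp
  qed
qed

lemma overpseudoprime_card_orbit:
  assumes "overpseudoprime n" "x \<in> {1..<n}"
  shows "card (orbit (\<lambda>x. 2 * x mod n) x) = ord n 2"
proof (rule card_orbit_eq_if_all_bounded[OF _ _ _ _ _ assms(2)])
  have cop: "coprime 2 n" and n: "n > 1"
    and eq: "n = card (cyclotomic_cosets n) * ord n 2 + 1"
    using assms(1) by (auto simp: overpseudoprime_def num_cyclotomic_cosets_def)
  show "2 * x mod n \<in> {1..<n}" if "x \<in> {1..<n}" for x
  proof -
    \<comment> \<open>As \<open>n\<close> is odd, it would have to divide \<open>x\<close>, but 0 <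
      x < n.\<close>
    have "\<not> n dvd 2 * x"
      using that cop by (auto simp: coprime_dvd_mult_right_iff coprime_commute dest: dvd_imp_le)
    then show ?thesis using n by (auto simp: dvd_eq_mod_eq_0)
  qed
  show "((\<lambda>x. 2 * x mod n) ^^ ord n 2) x = x" if "x \<in> {1..<n}" for x
  proof -
    have "[2 ^ ord n 2 * x = 1 * x] (mod n)"
      by (intro cong_mult ord cong_refl)
    then show ?thesis using that by (simp add: funpow_double_mod cong_def)
  qed
  show "0 < ord n 2"
    using cop by (simp add: coprime_commute ord_eq_0)
  show "card {1..<n} = card (orbit (\<lambda>x. 2 * x mod n) ` {1..<n}) * ord n 2"
    using eq by (simp add: cyclotomic_cosets_def)
qed simp

text \<open>Doubling n / p modulo \<open>n\<close> mirrors doubling 1 modulo \<open>p\<close>, so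
  the orbit of n / p closes after \<open>ord p 2\<close> steps, whereas every orbit has
  \<open>ord n 2\<close> elements.\<close>

lemma overpseudoprime_ord_prime_factor:
  assumes "overpseudoprime n" "prime p" "p dvd n"
  shows "ord p 2 = ord n 2"
proof (rule dvd_antisym)
  obtain x where x: "n = p * x"
    using assms(3) by blast
  have n: "odd n" "n > 1"
    using assms(1) by (auto simp: overpseudoprime_def)
  with x have "coprime p 2"
    by simp
  then have pos: "0 < ord p 2"
    using ord_eq_0 by blast
  show dvd: "ord p 2 dvd ord n 2"
    unfolding ord_divides[symmetric] using cong_dvd_modulus_nat[OF ord assms(3)] .
  have "0 < x"
    using x n by (cases x) auto
  then have "x \<in> {1..<n}"
    using x prime_gt_1_nat[OF assms(2)] by simp
  \<comment> \<open>Scaling a congruence modulo \<open>p\<close> by \<open>x\<close> gives one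
    modulo p * x = n.\<close>
  moreover have "[2 ^ ord p 2 * x = 1 * x] (mod n)"
    unfolding x using ord[of 2 p] by (simp add: cong_def mult_mod_left)
  ultimately have "card (orbit (\<lambda>x. 2 * x mod n) x) \<le> ord p 2"
    using pos by (intro card_orbit_le) (auto simp: funpow_double_mod cong_def)
  then have "ord n 2 \<le> ord p 2"
    using overpseudoprime_card_orbit[OF assms(1) \<open>x \<in> {1..<n}\<close>] by simp
  moreover have "0 < ord n 2"
    using n by (simp add: ord_eq_0 coprime_commute)
  ultimately show "ord n 2 dvd ord p 2"
    using dvd by (auto dest: dvd_imp_le)
qed

theorem theorem5:
  fixes n :: nat
  assumes "overpseudoprime n"
    and "\<And>p. wieferich_prime p \<Longrightarrow> \<not> p\<^sup>2 dvd n"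
  shows "squarefree n"
proof (rule ccontr)
  assume "\<not> squarefree n"
  moreover have n: "odd n" "n \<noteq> 0"
    using assms(1) by (auto simp: overpseudoprime_def)
  ultimately obtain p where p: "prime p" "p\<^sup>2 dvd n"
    by (auto simp: squarefree_factorial_semiring)
  then have "p dvd n"
    by (metis dvd_mult_left power2_eq_square)
  with n have "coprime p 2"
    by auto
  \<comment> \<open>This is the hypothesis of Fermat's little theorem for base 2.\<close>
  then have "\<not> p dvd 2"
    using p(1) by (metis coprime_absorb_left not_prime_unit)
  then have "ord p 2 dvd p - 1"
    using p(1) fermat_theorem by (simp add: ord_divides[symmetric])
  then have "ord n 2 dvd p - 1"
    using overpseudoprime_ord_prime_factor[OF assms(1) p(1) \<open>p dvd n\<close>] by simp
  \<comment> \<open>The congruence holds modulo \<open>n\<close>, hence modulo its divisor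
    \<open>p\<^sup>2\<close>.\<close>
  then have "[2 ^ (p - 1) = 1] (mod p\<^sup>2)"
    using p(2) cong_dvd_modulus_nat by (auto simp: ord_divides[symmetric])
  with p assms(2) show False
    by (auto simp: wieferich_prime_def)
qed

end
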